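(* For every $k\in\mathbb N$ with $n^{1/k}\in\mathbb N$, the algorithm $ACC_k$ described below solves the $n$-Interval problem: for every element $x\in\mathcal U$ and all $i\le j\le n$, its answer to BlockIntervalQuery$(x,i,j)$ equals $g_x^{i,j}$ exactly.
   Context: Block setting: elements come from a universe $\mathcal U$; a block algorithm processes a stream of blocks (each block is a set of elements; each element is added at most once to a given block) via ADD$(x)$ (add $x$ to the newest block) and ENDBLOCK() (a new empty block becomes the newest one). For $w\le n$, $g_x^w$ is the number of blocks among the last $w$ blocks that contain $x$, and $g_x^{i,j}=g_x^j-g_x^i$ for $i\le j\le n$. Algorithm $ACC_k$: let $d=n^{1/k}$. The block stream is partitioned into consecutive frames of $n$ blocks. Within a frame, each block is a level-0 segment, and for $1\le\ell\le k$ a level-$\ell$ segment consists of $d$ consecutive level-$(\ell-1)$ segments (the level-$k$ segment is the whole frame). For each $\ell\in\{0,\ldots,k-1\}$, when a level-$\ell$ segment ends, the algorithm stores a level-$\ell$ table recording, for each element, the number of blocks containing it from the beginning of the enclosing level-$(\ell+1)$ segment up to the end of this segment. It keeps $k$ incomplete tables with the same cumulative counts for segments that have started but not ended (each ADD$(x)$ increments $x$'s entry in all of them), and ghost tables retaining, for each level, the most recently overwritten table of that level from the previous frame. A query WinQuery$(x,w)$ returns $g_x^w$ computed as follows: the frequency of $x$ from the beginning of the current frame to the present is obtained by summing the incomplete level-0 count with the tables of the largest completed segments covering the frame prefix; if the $w$ most recent blocks lie within the current frame, the cumulative frequency before the window's first block (obtained from tables in the same way) is subtracted; otherwise, the frequency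 of $x$ in the previous frame (from its top-level table) is added and the cumulative frequency in the previous frame before the window's first block, obtained from the stored tables or, where those have been overwritten, from the ghost tables, is subtracted. BlockIntervalQuery$(x,i,j)$ returns WinQuery$(x,j)$ if $i=0$ and WinQuery$(x,j)-$WinQuery$(x,i)$ otherwise. *)

theory Defs
  imports Complex_Main
begin

section \<open>Block streams and the interval problem\<close>

datatype 'a block_op = Add 'a | EndBlock

text \<open>The blocks are listed newest first. The newest block is the one currently being filled; it is
  part of the stream from its creation on, so the first \<open>w\<close> entries are the last \<open>w\<close> blocks.\<close>

fun block_step :: "'a block_op \<Rightarrow> 'a set list \<Rightarrow> 'a set list" where
  "block_step (Add x) Bs = insert x (hd Bs) # tl Bs"
| "block_step EndBlock Bs = {} # Bs"

definition blocks :: "'a block_op list \<Rightarrow> 'a set list" where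
  "blocks ops = fold block_step ops [{}]"

text \<open>An element is added at most once to a given block.\<close>

definition admissible :: "'a block_op list \<Rightarrow> bool" where
  "admissible ops \<longleftrightarrow>
     (\<forall>pre x post. ops = pre @ Add x # post \<longrightarrow> x \<notin> hd (blocks pre))"

text \<open>The counts $g_x^w$ and $g_x^{i,j}$. If fewer than \<open>w\<close> blocks exist so far, all of them
  are counted.\<close>

definition block_freq :: "'a set list \<Rightarrow> 'a \<Rightarrow> nat \<Rightarrow> nat" where
  "block_freq Bs x w = length (filter (\<lambda>B. x \<in> B) (take w Bs))"

definition interval_freq :: "'a set list \<Rightarrow> 'a \<Rightarrow> nat \<Rightarrow> nat \<Rightarrow> int" where
  "interval_freq Bs x i j = int (block_freq Bs x j) - int (block_freq Bs x i)"

record ('s, 'a) block_algorithm =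
  alg_init :: 's
  alg_add :: "'a \<Rightarrow> 's \<Rightarrow> 's"
  alg_end_block :: "'s \<Rightarrow> 's"
  alg_interval_query :: "'s \<Rightarrow> 'a \<Rightarrow> nat \<Rightarrow> nat \<Rightarrow> int"

fun alg_step :: "('s, 'a) block_algorithm \<Rightarrow> 'a block_op \<Rightarrow> 's \<Rightarrow> 's" where
  "alg_step A (Add x) S = alg_add A x S"
| "alg_step A EndBlock S = alg_end_block A S"

definition alg_run :: "('s, 'a) block_algorithm \<Rightarrow> 'a block_op list \<Rightarrow> 's" where
  "alg_run A ops = fold (alg_step A) ops (alg_init A)"

definition solves_interval_problem :: "nat \<Rightarrow> ('s, 'a) block_algorithm \<Rightarrow> bool" where
  "solves_interval_problem n A \<longleftrightarrow>
     (\<forall>ops x i j. admissible ops \<longrightarrow> i \<le> j \<longrightarrow> j \<le> n \<longrightarrow>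
        alg_interval_query A (alg_run A ops) x i j = interval_freq (blocks ops) x i j)"

section \<open>The algorithm\<close>

text \<open>\<open>offset\<close> is the number of completed blocks of the current frame. The table of the \<open>s\<close>-th
  level-\<open>l\<close> segment of a frame (counting from 0) is kept in \<open>tables l s\<close>, so each frame overwrites
  the tables of the previous one slot by slot; only the levels \<open>l < k\<close> and the slots
  \<open>s < n div d ^ l\<close> are in use. Both \<open>tables l s\<close> and \<open>inc_tables l\<close> count from the
  beginning of the enclosing level-\<open>(l + 1)\<close> segment.\<close>

record 'a acc_state =
  offset :: nat
  tables :: "nat \<Rightarrow> nat \<Rightarrow> 'a \<Rightarrow> nat"
  inc_tables :: "nat \<Rightarrow> 'a \<Rightarrow> nat"
  ghost_tables :: "nat \<Rightarrow> 'a \<Rightarrow> nat"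

text \<open>The number $d = n^{1/k}$ of parts of a segment; the rounding is vacuous when the
  root is a natural number.\<close>

definition acc_d :: "nat \<Rightarrow> nat \<Rightarrow> nat" where
  "acc_d k n = nat \<lfloor>root k (real n)\<rfloor>"

definition acc_init :: "'a acc_state" where
  "acc_init = \<lparr>offset = 0, tables = (\<lambda>_ _ _. 0), inc_tables = (\<lambda>_ _. 0),
     ghost_tables = (\<lambda>_ _. 0)\<rparr>"

definition acc_add :: "nat \<Rightarrow> 'a \<Rightarrow> 'a acc_state \<Rightarrow> 'a acc_state" where
  "acc_add k x S = S\<lparr>inc_tables :=
     (\<lambda>l y. if l < k \<and> y = x then inc_tables S l y + 1 else inc_tables S l y)\<rparr>"

definition acc_end_block :: "nat \<Rightarrow> nat \<Rightarrow> 'a acc_state \<Rightarrow> 'a acc_state" where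
  "acc_end_block k n S =
     (let d = acc_d k n;
          m = offset S + 1;
          ended = (\<lambda>l. l < k \<and> d ^ l dvd m);
          slot = (\<lambda>l. m div d ^ l - 1)
      in \<lparr>offset = m mod n,
          tables = (\<lambda>l s. if ended l \<and> s = slot l then inc_tables S l else tables S l s),
          inc_tables = (\<lambda>l. if d ^ (l + 1) dvd m then (\<lambda>_. 0) else inc_tables S l),
          ghost_tables = (\<lambda>l. if ended l then tables S l (slot l) else ghost_tables S l)\<rparr>)"

text \<open>The first \<open>p < n\<close> blocks of a frame contain \<open>p div d ^ l\<close> complete level-\<open>l\<close> segments, of which
  the last \<open>(p div d ^ l) mod d\<close> are not covered by a complete level-\<open>(l + 1)\<close> segment.
  If there are any, the table of the last one counts all of them.
  In the following function, \<open>T l s\<close> is the table to be used for segment \<open>s\<close> of level \<open>l\<close>, and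
  only the levels from \<open>l0\<close> on contribute.\<close>

definition acc_prefix ::
  "nat \<Rightarrow> nat \<Rightarrow> nat \<Rightarrow> (nat \<Rightarrow> nat \<Rightarrow> 'a \<Rightarrow> nat) \<Rightarrow> 'a \<Rightarrow> nat \<Rightarrow> nat" where
  "acc_prefix k n l0 T x p =
     (let d = acc_d k n
      in \<Sum>l = l0..<k. if (p div d ^ l) mod d = 0 then 0 else T l (p div d ^ l - 1) x)"

text \<open>The blocks of the current level-1 segment, including the newest block, are counted by
  the incomplete level-0 table.\<close>

definition acc_current :: "nat \<Rightarrow> nat \<Rightarrow> 'a acc_state \<Rightarrow> 'a \<Rightarrow> nat" where
  "acc_current k n S x = inc_tables S 0 x + acc_prefix k n 1 (tables S) x (offset S)"

text \<open>The tables of the previous frame. Slot \<open>s\<close> of level \<open>l\<close> has been overwritten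
  if that segment has already ended in the current frame.\<close>

definition acc_prev_tables :: "nat \<Rightarrow> nat \<Rightarrow> 'a acc_state \<Rightarrow> nat \<Rightarrow> nat \<Rightarrow> 'a \<Rightarrow> nat" where
  "acc_prev_tables k n S l s =
     (if s < offset S div acc_d k n ^ l then ghost_tables S l else tables S l s)"

text \<open>The current frame has \<open>offset S + 1\<close> blocks so far, including the newest one. The empty
  window has no first block and its count is 0. The top-level table of the previous frame is that of
  its last level-\<open>(k - 1)\<close> segment, which ends with the frame.\<close>

definition acc_win_query :: "nat \<Rightarrow> nat \<Rightarrow> 'a acc_state \<Rightarrow> 'a \<Rightarrow> nat \<Rightarrow> int" where
  "acc_win_query k n S x w =
     (let m = offset S + 1
      in if w = 0 then 0
         else if w \<le> m then
           int (acc_current k n S x) - int (acc_prefix k n 0 (tables S) x (m - w))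
         else
           int (acc_current k n S x) + int (tables S (k - 1) (acc_d k n - 1) x)
             - int (acc_prefix k n 0 (acc_prev_tables k n S) x (n + m - w)))"

definition acc_interval_query ::
  "nat \<Rightarrow> nat \<Rightarrow> 'a acc_state \<Rightarrow> 'a \<Rightarrow> nat \<Rightarrow> nat \<Rightarrow> int" where
  "acc_interval_query k n S x i j =
     (if i = 0 then acc_win_query k n S x j
      else acc_win_query k n S x j - acc_win_query k n S x i)"

definition ACC :: "nat \<Rightarrow> nat \<Rightarrow> ('a acc_state, 'a) block_algorithm" where
  "ACC k n = \<lparr>alg_init = acc_init, alg_add = acc_add k, alg_end_block = acc_end_block k n,
     alg_interval_query = acc_interval_query k n\<rparr>"

end

theory Submission
  imports Defs
begin

text \<open>Prepend a frame of \<open>n\<close> empty blocks to the stream, so that there always is a previous frame,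
  and let \<open>C x t\<close> be the number of the first \<open>t\<close> blocks that contain \<open>x\<close>. Every table is then a
  difference of two values of \<open>C\<close>. Once \<open>N\<close> blocks are completed, the stored tables of level \<open>l\<close>
  are those of the segments that end at the multiples of \<open>d ^ l\<close> in the interval \<open>(N - n, N]\<close>, and
  the ghost table belongs to the last multiple of \<open>d ^ l\<close> outside of it. The sum over the levels in
  a prefix query telescopes.\<close>

section \<open>Arithmetic of segment ends and table slots\<close>

lemma div_Suc_not_dvd: "\<not> D dvd Suc N \<Longrightarrow> Suc N div D = N div D"
  by (simp add: div_Suc dvd_eq_mod_eq_0)

lemma pred_mult_div: "0 < q \<Longrightarrow> 0 < D \<Longrightarrow> (q * D - 1) div D = q - (1::nat)"
proof (cases q)
  case (Suc m)
  assume "0 < D"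
  then have "q * D - 1 = D - 1 + m * D" using Suc by simp
  then have "(q * D - 1) div D = m + (D - 1) div D"
    using \<open>0 < D\<close> by (simp only: div_mult_self1)
  then show ?thesis using Suc \<open>0 < D\<close> by simp
qed simp

lemma dvd_div_pred: "D dvd Suc m \<Longrightarrow> Suc m div D - 1 = m div (D::nat)"
  by (auto simp: div_Suc)

lemma mod_eq_imp_eq_nat:
  fixes a b r :: nat
  assumes "a mod r = b mod r" "a \<le> b" "b < a + r"
  shows "a = b"
proof -
  have "r dvd b - a" using assms(1,2) by (metis mod_eq_dvd_iff_nat)
  moreover have "b - a < r" using assms by linarith
  ultimately show ?thesis using assms(2) nat_dvd_not_less by (metis diff_is_0_eq le_antisym neq0_conv)
qed

text \<open>The segment ending at \<open>a * D\<close> has slot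
  \<open>(a - 1) mod (n div D)\<close>, and for two ends less than \<open>n\<close> apart these
  indices differ by less than \<open>n div D\<close>. Hence writing a table never destroys another
  live one.\<close>

lemma slot_eq_imp_eq:
  fixes D n e M :: nat
  assumes "D dvd n" "D dvd e" "D dvd M" "0 < e" "e \<le> M" "M < e + n"
    and eq: "((e - 1) mod n) div D = ((M - 1) mod n) div D"
  shows "e = M"
proof -
  obtain r where r: "n = D * r" using assms(1) by blast
  obtain a where a: "e = a * D" using assms(2) by (metis dvd_def mult.commute)
  obtain b where b: "M = b * D" using assms(3) by (metis dvd_def mult.commute)
  have D: "0 < D" and a0: "0 < a" and b0: "0 < b" using a b assms by (auto intro!: gr0I)
  have ab: "a \<le> b" using assms(5) a b D by simp
  have "b * D < (a + r) * D" using assms(6) a b r by (simp add: algebra_simps)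
  then have br: "b < a + r" by simp
  have slot: "((q * D - 1) mod n) div D = (q - 1) mod r" if "0 < q" for q
    using that D by (simp only: r mod_mult2_eq) (simp add: pred_mult_div[simplified])
  have "(a - 1) mod r = (b - 1) mod r" using eq a b slot a0 b0 by metis
  then have "a - 1 = b - 1" by (rule mod_eq_imp_eq_nat) (use ab br a0 in linarith)+
  then show ?thesis using a b a0 b0 by (metis Suc_pred')
qed

section \<open>The invariant and its preservation under updates\<close>

locale acc_params =
  fixes k n d :: nat
  assumes k_pos: "0 < k" and d_pos: "0 < d" and n_eq: "n = d ^ k" and d_eq: "acc_d k n = d"
begin

lemma n_pos: "0 < n"
  using d_pos n_eq by simp

lemma pow_dvd_n: "l \<le> k \<Longrightarrow> d ^ l dvd n"
  using n_eq by (simp add: le_imp_power_dvd)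

text \<open>Carries the tests of \<open>acc_end_block\<close> on the offset over to the absolute
  block count.\<close>

lemma dvd_Suc_mod_n: "l \<le> k \<Longrightarrow> d ^ l dvd Suc (N mod n) \<longleftrightarrow> d ^ l dvd Suc N"
  using pow_dvd_n by (metis dvd_mod_iff mod_Suc_eq)

text \<open>\<open>e\<close> is the absolute end of a level-\<open>l\<close> segment. Rounding down
  \<open>e - 1\<close> instead of \<open>e\<close> finds the start of the enclosing segment even
  when that segment also ends at \<open>e\<close>.\<close>

definition seg_count :: "('a \<Rightarrow> nat \<Rightarrow> int) \<Rightarrow> nat \<Rightarrow> nat \<Rightarrow> 'a \<Rightarrow> int" where
  "seg_count C l e x = C x e - C x ((e - 1) div d ^ (l + 1) * d ^ (l + 1))"

text \<open>\<open>N\<close> includes the padding, and \<open>C x (N + 1)\<close> also counts the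
  newest block. The last level-\<open>l\<close> end is \<open>N div d ^ l * d ^ l\<close>; it shares
  its slot with the end \<open>n\<close> blocks earlier, whose table is the ghost.\<close>

definition acc_inv :: "nat \<Rightarrow> ('a \<Rightarrow> nat \<Rightarrow> int) \<Rightarrow> 'a acc_state \<Rightarrow> bool" where
  "acc_inv N C S \<longleftrightarrow> n \<le> N \<and> offset S = N mod n \<and>
     (\<forall>l<k. \<forall>x. int (inc_tables S l x) = C x (N + 1) - C x (N div d ^ (l + 1) * d ^ (l + 1))) \<and>
     (\<forall>l<k. \<forall>e x. d ^ l dvd e \<longrightarrow> N < e + n \<longrightarrow> e \<le> N \<longrightarrow>
        int (tables S l ((e - 1) mod n div d ^ l) x) = seg_count C l e x) \<and>
     (\<forall>l<k. \<forall>x. int (ghost_tables S l x) = seg_count C l (N div d ^ l * d ^ l - n) x)"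

lemma acc_inv_init:
  assumes "\<And>x t. C x t = 0"
  shows "acc_inv n C acc_init"
  using assms by (auto simp: acc_inv_def acc_init_def seg_count_def)

text \<open>Stored tables, ghosts and the subtracted terms of the incomplete tables refer to
  positions up to \<open>N\<close>, where an addition changes nothing; only
  \<open>C x (N + 1)\<close> grows, along with the incomplete entries.\<close>

lemma acc_inv_add:
  assumes inv: "acc_inv N C S"
    and C': "\<And>y t. C' y t = C y t + (if y = x \<and> N < t then 1 else 0)"
  shows "acc_inv N C' (acc_add k x S)"
proof -
  have le: "C' y t = C y t" if "t \<le> N" for y t
    using that by (simp add: C')
  have seg: "seg_count C' l e y = seg_count C l e y" if "e \<le> N" for l e y
  proof -
    have "(e - 1) div d ^ (l + 1) * d ^ (l + 1) \<le> N"
      using that by (metis diff_le_self div_times_less_eq_dividend le_trans)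
    then show ?thesis using that by (simp add: seg_count_def le)
  qed
  have "N div D * D - n \<le> N" for D
    by (meson diff_le_self div_times_less_eq_dividend le_trans)
  moreover have "N div D * D \<le> N" for D by simp
  ultimately show ?thesis
    using inv unfolding acc_inv_def
    by (simp add: seg acc_add_def le C'[of _ "Suc N"] del: power_Suc)
qed

text \<open>The new block is empty, hence the hypothesis on \<open>C\<close>. At a segment end the
  incomplete table moves into its slot and the displaced table becomes the ghost.\<close>

lemma acc_inv_end_block:
  assumes inv: "acc_inv N C S" and C: "\<And>x. C x (N + 2) = C x (N + 1)"
  shows "acc_inv (N + 1) C (acc_end_block k n S)"
proof -
  from inv have nN: "n \<le> N" and off: "offset S = N mod n"
    and inc: "\<And>l x. l < k \<Longrightarrow>
      int (inc_tables S l x) = C x (N + 1) - C x (N div d ^ (l + 1) * d ^ (l + 1))"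
    and tab: "\<And>l e x. l < k \<Longrightarrow> d ^ l dvd e \<Longrightarrow> N < e + n \<Longrightarrow> e \<le> N \<Longrightarrow>
        int (tables S l ((e - 1) mod n div d ^ l) x) = seg_count C l e x"
    and ghost: "\<And>l x. l < k \<Longrightarrow>
      int (ghost_tables S l x) = seg_count C l (N div d ^ l * d ^ l - n) x"
    unfolding acc_inv_def by auto
  define S' where "S' = acc_end_block k n S"
  have off': "offset S' = (N + 1) mod n"
    by (simp add: S'_def acc_end_block_def Let_def off mod_Suc_eq)
  have inc_S': "inc_tables S' l = (if d ^ (l + 1) dvd Suc N then (\<lambda>_. 0) else inc_tables S l)"
    if "l < k" for l
    using that dvd_Suc_mod_n[of "l + 1" N]
    by (simp add: S'_def acc_end_block_def Let_def off d_eq)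
  have slot: "Suc (N mod n) div d ^ l - 1 = N mod n div d ^ l" if "l < k" "d ^ l dvd Suc N" for l
    using that by (intro dvd_div_pred) (simp add: dvd_Suc_mod_n)
  have tab_S': "tables S' l s =
      (if d ^ l dvd Suc N \<and> s = N mod n div d ^ l then inc_tables S l else tables S l s)"
    if "l < k" for l s
    using that dvd_Suc_mod_n[of l N] slot[of l]
    by (auto simp: S'_def acc_end_block_def Let_def off d_eq)
  have ghost_S': "ghost_tables S' l =
      (if d ^ l dvd Suc N then tables S l (N mod n div d ^ l) else ghost_tables S l)"
    if "l < k" for l
    using that dvd_Suc_mod_n[of l N] slot[of l]
    by (auto simp: S'_def acc_end_block_def Let_def off d_eq)
  have "int (inc_tables S' l x) =
      C x (N + 1 + 1) - C x ((N + 1) div d ^ (l + 1) * d ^ (l + 1))" if "l < k" for l x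
  proof (cases "d ^ (l + 1) dvd Suc N")
    case True
    then have "(N + 1) div d ^ (l + 1) * d ^ (l + 1) = N + 1" by simp
    then show ?thesis using True inc_S'[OF that] C[of x] by (simp del: power_Suc)
  next
    case False
    then have "(N + 1) div d ^ (l + 1) = N div d ^ (l + 1)"
      using div_Suc_not_dvd[OF False] by simp
    then show ?thesis using False inc_S'[OF that] C[of x] inc[OF that] by simp
  qed
  moreover have "int (tables S' l ((e - 1) mod n div d ^ l) x) = seg_count C l e x"
    if "l < k" "d ^ l dvd e" "N + 1 < e + n" "e \<le> N + 1" for l e x
  proof (cases "e = N + 1")
    \<comment> \<open>The table just stored: \<open>e - 1 = N\<close>, so \<open>seg_count\<close>
      starts where the incomplete table does.\<close>
    case True
    then show ?thesis
      using that inc[OF that(1)] by (simp add: tab_S' seg_count_def)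
  next
    case False
    have "\<not> (d ^ l dvd Suc N \<and> (e - 1) mod n div d ^ l = N mod n div d ^ l)"
    proof
      assume A: "d ^ l dvd Suc N \<and> (e - 1) mod n div d ^ l = N mod n div d ^ l"
      have "e = Suc N"
        by (rule slot_eq_imp_eq[of "d ^ l" n]) (use A that nN pow_dvd_n in auto)
      then show False using False by simp
    qed
    then show ?thesis
      using that False tab[of l e x] by (auto simp: tab_S')
  qed
  moreover have "int (ghost_tables S' l x) = seg_count C l ((N + 1) div d ^ l * d ^ l - n) x"
    if "l < k" for l x
  proof (cases "d ^ l dvd Suc N")
    case True
    \<comment> \<open>\<open>Suc N - n\<close> is the oldest possible live end, one frame before the
      end now reached, so its table is the displaced one.\<close>
    have "(Suc N - n - 1) mod n = N mod n"
      using nN by (simp add: le_mod_geq)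
    moreover have "d ^ l dvd Suc N - n"
      using True pow_dvd_n[of l] that by (simp add: dvd_diff_nat)
    ultimately show ?thesis
      using True tab[OF that, of "Suc N - n" x] nN n_pos ghost_S'[OF that] by simp
  next
    case False
    then show ?thesis
      using ghost_S'[OF that] ghost[OF that] div_Suc_not_dvd[OF False] by simp
  qed
  ultimately show ?thesis
    using nN off' unfolding acc_inv_def S'_def by auto
qed

section \<open>Correctness of prefix and window queries\<close>

text \<open>Let \<open>P l\<close> be position \<open>p\<close> of the frame starting at
  \<open>b\<close>, rounded down to a level-\<open>l\<close> boundary. Level \<open>l\<close>
  contributes \<open>C x (P l) - C x (P (Suc l))\<close>, and \<open>P k = b\<close> as
  \<open>p < n\<close>. Keeping \<open>T\<close> arbitrary covers both \<open>tables\<close> and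
  \<open>acc_prev_tables\<close>.\<close>

lemma prefix_eq:
  assumes p: "p < n" and l0: "l0 \<le> k" and b: "n dvd b"
    and T: "\<And>l. l0 \<le> l \<Longrightarrow> l < k \<Longrightarrow> (p div d ^ l) mod d \<noteq> 0 \<Longrightarrow>
      int (T l (p div d ^ l - 1) x) = seg_count C l (b + p div d ^ l * d ^ l) x"
  shows "int (acc_prefix k n l0 T x p) = C x (b + p div d ^ l0 * d ^ l0) - C x b"
proof -
  define P where "P = (\<lambda>l. b + p div d ^ l * d ^ l)"
  have level: "int (if (p div d ^ l) mod d = 0 then 0 else T l (p div d ^ l - 1) x) =
      C x (P l) - C x (P (Suc l))" if l: "l0 \<le> l" "l < k" for l
  proof -
    have nest: "p div d ^ Suc l = p div d ^ l div d"
      by (metis div_mult2_eq power_Suc2)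
    show ?thesis
    proof (cases "(p div d ^ l) mod d = 0")
      case True
      then have "p div d ^ l = p div d ^ l div d * d"
        by auto
      then have "P l = P (Suc l)"
        unfolding P_def by (metis mult.assoc nest power_Suc)
      then show ?thesis using True by simp
    next
      case False
      define q where "q = p div d ^ l"
      obtain c where c: "b = c * d ^ Suc l"
        using b pow_dvd_n[of "Suc l"] l by (metis Suc_leI dvd_def dvd_trans mult.commute)
      have q: "0 < q" using False by (auto simp: q_def intro!: gr0I)
      have bl: "b + q * d ^ l = (c * d + q) * d ^ l"
        using c by (simp add: algebra_simps)
      have "(b + q * d ^ l - 1) div d ^ Suc l = (b + q * d ^ l - 1) div d ^ l div d"
        by (metis div_mult2_eq power_Suc2)
      also have "(b + q * d ^ l - 1) div d ^ l = c * d + q - 1"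
        unfolding bl by (rule pred_mult_div) (use q d_pos in auto)
      also have "(c * d + q - 1) div d = c + (q - 1) div d"
        using q d_pos by (metis Nat.add_diff_assoc Suc_leI One_nat_def div_mult_self3 add.commute neq0_conv)
      \<comment> \<open>Since \<open>d\<close> does not divide \<open>q\<close>, the shift by one in
        \<open>seg_count\<close> leaves the enclosing segment unchanged.\<close>
      also have "(q - 1) div d = q div d"
        using False q div_Suc_not_dvd[of d "q - 1"] by (simp add: q_def dvd_eq_mod_eq_0)
      finally have "(b + q * d ^ l - 1) div d ^ Suc l * d ^ Suc l = P (Suc l)"
        by (simp only: P_def nest q_def c add_mult_distrib)
      then show ?thesis
        using T[OF l False] False by (simp add: seg_count_def P_def q_def)
    qed
  qed
  have "int (acc_prefix k n l0 T x p) = (\<Sum>l = l0..<k. C x (P l) - C x (P (Suc l)))"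
    by (simp only: acc_prefix_def Let_def d_eq of_nat_sum) (intro sum.cong refl level, auto)
  also have "\<dots> = C x (P l0) - C x (P k)"
    using sum_Suc_diff'[OF l0, of "\<lambda>l. - C x (P l)"] by (simp add: algebra_simps)
  also have "P k = b" using p n_eq by (simp add: P_def)
  finally show ?thesis by (simp add: P_def)
qed

lemma win_query_eq:
  assumes inv: "acc_inv N C S" and w: "w \<le> n"
  shows "acc_win_query k n S x w = C x (N + 1) - C x (N + 1 - w)"
proof (cases "w = 0")
  case True
  then show ?thesis by (simp add: acc_win_query_def Let_def)
next
  case False
  from inv have nN: "n \<le> N" and off: "offset S = N mod n"
    and inc: "\<And>l x. l < k \<Longrightarrow>
      int (inc_tables S l x) = C x (N + 1) - C x (N div d ^ (l + 1) * d ^ (l + 1))"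
    and tab: "\<And>l e x. l < k \<Longrightarrow> d ^ l dvd e \<Longrightarrow> N < e + n \<Longrightarrow> e \<le> N \<Longrightarrow>
        int (tables S l ((e - 1) mod n div d ^ l) x) = seg_count C l e x"
    and ghost: "\<And>l x. l < k \<Longrightarrow>
      int (ghost_tables S l x) = seg_count C l (N div d ^ l * d ^ l - n) x"
    unfolding acc_inv_def by auto
  \<comment> \<open>\<open>b\<close> is the start of the current frame and \<open>o'\<close> the
    number of its completed blocks; the padding ensures a previous frame.\<close>
  define o' where "o' = N mod n"
  define b where "b = N div n * n"
  have N: "N = b + o'" by (simp add: b_def o'_def)
  have o'n: "o' < n" using n_pos by (simp add: o'_def)
  have nb: "n dvd b" by (simp add: b_def)
  have "N div n > 0" using nN n_pos by (simp add: div_greater_zero_iff)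
  then have bn: "n \<le> b" unfolding b_def using n_pos by simp
  have slot: "(c + p div d ^ l * d ^ l - 1) mod n div d ^ l = p div d ^ l - 1"
    if "p < n" "0 < p div d ^ l" and c: "n dvd c" for c p l
  proof -
    have "p div d ^ l * d ^ l \<le> p" by simp
    then have "p div d ^ l * d ^ l - 1 < n" using that by linarith
    moreover have "(c + p div d ^ l * d ^ l - 1) mod n = (p div d ^ l * d ^ l - 1) mod n"
    proof -
      have "c + p div d ^ l * d ^ l - 1 = c + (p div d ^ l * d ^ l - 1)"
        using that d_pos by (simp add: Suc_leI)
      moreover obtain c' where "c = n * c'" using c by blast
      ultimately show ?thesis by simp
    qed
    ultimately show ?thesis using that d_pos by (simp add: pred_mult_div[simplified])
  qed
  have dvd_seg: "d ^ l dvd c + p div d ^ l * d ^ l" if "l < k" "n dvd c" for l c p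
    using that pow_dvd_n[of l] by (meson dvd_add dvd_trans dvd_triv_right less_imp_le)
  have shift: "(c + m) div d ^ l * d ^ l = c + m div d ^ l * d ^ l" if l: "l \<le> k" and c: "n dvd c" for l c m
  proof -
    obtain r where "c = d ^ l * r" using l c pow_dvd_n by (meson dvdE dvd_trans)
    then show ?thesis using d_pos by (simp add: algebra_simps)
  qed
  have cur_tab: "int (tables S l (p div d ^ l - 1) x) = seg_count C l (b + p div d ^ l * d ^ l) x"
    if "p \<le> o'" "l < k" "(p div d ^ l) mod d \<noteq> 0" for p l
  proof -
    have p: "0 < p div d ^ l" using that(3) by (metis gr0I mod_0)
    moreover have "p div d ^ l * d ^ l \<le> p" by simp
    then have "b + p div d ^ l * d ^ l \<le> N" using that(1) N by linarith
    ultimately show ?thesis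
      using tab[OF that(2) dvd_seg[OF that(2) nb, of p], of x] slot[of p l b] that(1) o'n N nb
      by simp
  qed
  \<comment> \<open>Levels from 1 on reach the start of the current level-1 segment, where the
    incomplete level-0 table takes over.\<close>
  have "int (acc_prefix k n 1 (tables S) x o') = C x (b + o' div d ^ 1 * d ^ 1) - C x b"
    by (rule prefix_eq) (use o'n k_pos nb cur_tab in auto)
  moreover have "int (inc_tables S 0 x) = C x (N + 1) - C x (b + o' div d ^ 1 * d ^ 1)"
    using inc[of 0 x] k_pos shift[of 1 b o'] nb N by simp
  ultimately have cur: "int (acc_current k n S x) = C x (N + 1) - C x b"
    by (simp add: acc_current_def off o'_def)
  show ?thesis
  proof (cases "w \<le> o' + 1")
    case True
    have "int (acc_prefix k n 0 (tables S) x (o' + 1 - w)) =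
        C x (b + (o' + 1 - w) div d ^ 0 * d ^ 0) - C x b"
      by (rule prefix_eq) (use o'n nb cur_tab False in auto)
    moreover have "b + (o' + 1 - w) = N + 1 - w" using True N by simp
    ultimately show ?thesis
      using True False cur by (simp add: acc_win_query_def Let_def off o'_def)
  next
    case w_gt: False
    define c where "c = b - n"
    have b: "b = c + n" using bn by (simp add: c_def)
    have nc: "n dvd c" using nb bn by (simp add: c_def)
    \<comment> \<open>The number of blocks of the previous frame before the window;
      \<open>w \<le> n\<close> gives \<open>o' < p\<close>.\<close>
    define p where "p = n + (o' + 1) - w"
    have p: "p < n" "o' < p" using w_gt w by (auto simp: p_def)
    have prev_tab: "int (acc_prev_tables k n S l (p div d ^ l - 1) x) =
        seg_count C l (c + p div d ^ l * d ^ l) x"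
      if l: "l < k" and nz: "(p div d ^ l) mod d \<noteq> 0" for l
    proof -
      have p0: "0 < p div d ^ l" using nz by (metis gr0I mod_0)
      have le: "o' div d ^ l \<le> p div d ^ l" using p by (simp add: div_le_mono)
      show ?thesis
      proof (cases "p div d ^ l - 1 < o' div d ^ l")
        \<comment> \<open>The slot is overwritten, but \<open>o' < p\<close> forces it to be the
          last overwritten one: one ghost per level suffices.\<close>
        case True
        then have "p div d ^ l = o' div d ^ l" using le by linarith
        moreover have "N div d ^ l * d ^ l - n = c + o' div d ^ l * d ^ l"
          using shift[of l b o'] l nb N b by simp
        ultimately show ?thesis
          using True ghost[OF l, of x] by (simp add: acc_prev_tables_def d_eq off o'_def)
      next
        \<comment> \<open>The segment ends beyond position \<open>o'\<close> of the previous frame,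
          so its end is less than \<open>n\<close> before \<open>N\<close> and its table is
          live.\<close>
        case F: False
        then have "o' div d ^ l + 1 \<le> p div d ^ l" using p0 by linarith
        then have "(o' div d ^ l + 1) * d ^ l \<le> p div d ^ l * d ^ l" by (rule mult_le_mono1)
        moreover have "o' < (o' div d ^ l + 1) * d ^ l"
          using d_pos dividend_less_div_times[of "d ^ l" o'] by simp
        ultimately have "o' < p div d ^ l * d ^ l" by linarith
        moreover have "p div d ^ l * d ^ l \<le> p" by simp
        ultimately have "N < c + p div d ^ l * d ^ l + n" "c + p div d ^ l * d ^ l \<le> N"
          using N b p by linarith+
        then show ?thesis
          using F tab[OF l dvd_seg[OF l nc, of p], of x] slot[OF p(1) p0 nc]
          by (simp add: acc_prev_tables_def d_eq off o'_def)
      qed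
    qed
    have "int (acc_prefix k n 0 (acc_prev_tables k n S) x p) =
        C x (c + p div d ^ 0 * d ^ 0) - C x c"
      by (rule prefix_eq) (use p nc prev_tab in auto)
    \<comment> \<open>This segment ends at \<open>b\<close>, its enclosing frame starts at
      \<open>c\<close>, and \<open>b \<le> N < b + n\<close> keeps its table live.\<close>
    moreover have "int (tables S (k - 1) (d - 1) x) = C x b - C x c"
    proof -
      have n: "n = d * d ^ (k - 1)" using n_eq k_pos by (cases k) auto
      obtain c' where c': "c = n * c'" using nc by blast
      have b1: "b - 1 = n * c' + (n - 1)" using b c' n_pos by simp
      have "(b - 1) mod n = n - 1"
        using n_pos unfolding b1 mod_mult_self4 by simp
      moreover have "(n - 1) div d ^ (k - 1) = d - 1"
        using d_pos pred_mult_div[of d "d ^ (k - 1)"] n by simp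
      moreover have "(b - 1) div n * n = c"
      proof -
        have "(b - 1) div n = c' + (n - 1) div n"
          unfolding b1 by (rule div_mult_self4) (use n_pos in simp)
        then show ?thesis using n_pos c' by simp
      qed
      moreover have "d ^ (k - 1) dvd b" using pow_dvd_n[of "k - 1"] nb by (meson diff_le_self dvd_trans)
      moreover have "d ^ (k - 1 + 1) = n" using k_pos n_eq by simp
      moreover have "k - 1 < k" "N < b + n" "b \<le> N" using k_pos N o'n by simp_all
      ultimately show ?thesis
        using tab[of "k - 1" b x] by (simp only: seg_count_def)
    qed
    moreover have "c + p = N + 1 - w" using N b w p_def by simp
    ultimately show ?thesis
      using w_gt False cur by (simp add: acc_win_query_def Let_def off o'_def p_def d_eq)
  qed
qed

end

section \<open>Counts over the padded block stream\<close>

text \<open>The instance of \<open>C\<close>: blocks are listed oldest first, and the count is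
  constant beyond the end of \<open>V\<close>.\<close>

definition prefix_freq :: "'a set list \<Rightarrow> 'a \<Rightarrow> nat \<Rightarrow> int" where
  "prefix_freq V x t = int (length (filter (\<lambda>B. x \<in> B) (take t V)))"

lemma blocks_snoc: "blocks (ops @ [p]) = block_step p (blocks ops)"
  by (simp add: blocks_def)

lemma blocks_nonempty: "blocks ops \<noteq> []"
proof (induction ops rule: rev_induct)
  case Nil
  then show ?case by (simp add: blocks_def)
next
  case (snoc p ops)
  then show ?case by (cases p) (simp_all add: blocks_snoc)
qed

lemma admissible_appendD: "admissible (ops @ ops') \<Longrightarrow> admissible ops"
  unfolding admissible_def by simp

text \<open>The window is a suffix of \<open>V\<close>. Padding blocks are empty, so a window longer
  than the stream gains nothing from them.\<close>

lemma block_freq_eq: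
  fixes Bs :: "'a set list"
  assumes "w \<le> n"
  defines "V \<equiv> replicate n {} @ rev Bs"
  shows "int (block_freq Bs x w) = prefix_freq V x (length V) - prefix_freq V x (length V - w)"
proof -
  have "filter (\<lambda>B. x \<in> B) (take w (rev V)) = filter (\<lambda>B. x \<in> B) (take w Bs)"
    by (simp add: V_def)
  moreover have "take w (rev V) = rev (drop (length V - w) V)"
    by (simp add: take_rev)
  ultimately have "block_freq Bs x w = length (filter (\<lambda>B. x \<in> B) (drop (length V - w) V))"
    by (metis block_freq_def length_rev rev_filter)
  moreover have "length (filter (\<lambda>B. x \<in> B) V) =
      length (filter (\<lambda>B. x \<in> B) (take (length V - w) V)) +
      length (filter (\<lambda>B. x \<in> B) (drop (length V - w) V))"
    by (metis append_take_drop_id filter_append length_append)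
  ultimately show ?thesis by (simp add: prefix_freq_def)
qed

context acc_params
begin

lemma acc_inv_run:
  assumes "admissible ops"
  shows "acc_inv (n + length (blocks ops) - 1)
    (prefix_freq (replicate n {} @ rev (blocks ops))) (alg_run (ACC k n) ops)"
  using assms
proof (induction ops rule: rev_induct)
  case Nil
  have "prefix_freq (replicate n {} @ [{}]) x t = 0" for x :: 'a and t
    by (auto simp: prefix_freq_def filter_empty_conv dest!: in_set_takeD)
  then show ?case by (simp add: acc_inv_init blocks_def alg_run_def ACC_def)
next
  case (snoc p ops)
  let ?N = "n + length (blocks ops) - 1"
  obtain B Bs where Bs: "blocks ops = B # Bs"
    using blocks_nonempty[of ops] by (cases "blocks ops") auto
  have IH: "acc_inv ?N (prefix_freq (replicate n {} @ rev (blocks ops))) (alg_run (ACC k n) ops)"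
    using snoc admissible_appendD by blast
  show ?case
  proof (cases p)
    case (Add x)
    have x: "x \<notin> B"
      using snoc.prems Bs unfolding Add admissible_def by fastforce
    \<comment> \<open>\<open>W\<close> holds the padding and the completed blocks, so adding to the
      newest block affects only counts at \<open>t > ?N\<close>.\<close>
    define W where "W = replicate n {} @ rev Bs"
    have W: "replicate n {} @ rev (blocks ops) = W @ [B]" by (simp add: W_def Bs)
    have len: "length W = ?N" by (simp add: W_def Bs)
    have "prefix_freq (W @ [insert x B]) y t =
        prefix_freq (W @ [B]) y t + (if y = x \<and> ?N < t then 1 else 0)" for y t
    proof (cases "length W < t")
      case True
      then obtain s where "t = Suc (length W + s)" using less_imp_Suc_add by blast
      then show ?thesis using x True len by (auto simp: prefix_freq_def)
    next
      case False
      then show ?thesis using len by (simp add: prefix_freq_def)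
    qed
    from acc_inv_add[OF IH[unfolded W] this]
    show ?thesis
      by (simp add: Add blocks_snoc Bs W_def alg_run_def ACC_def)
  next
    case EndBlock
    \<comment> \<open>An empty newest block lets the same count function serve before and after the
      step.\<close>
    have C: "prefix_freq (V @ [{}]) = prefix_freq V" for V :: "'a set list"
    proof (intro ext)
      show "prefix_freq (V @ [{}]) x t = prefix_freq V x t" for x t
        by (cases "t - length V") (simp_all add: prefix_freq_def)
    qed
    have "acc_inv (?N + 1) (prefix_freq (replicate n {} @ rev (blocks ops)))
        (acc_end_block k n (alg_run (ACC k n) ops))"
      by (rule acc_inv_end_block[OF IH]) (simp add: prefix_freq_def Bs)
    then show ?thesis
      using C[of "replicate n {} @ rev (blocks ops)"]
      by (simp add: EndBlock blocks_snoc Bs alg_run_def ACC_def)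
  qed
qed

lemma win_query_run:
  assumes "admissible ops" "w \<le> n"
  shows "acc_win_query k n (alg_run (ACC k n) ops) x w = int (block_freq (blocks ops) x w)"
proof -
  have "length (blocks ops) > 0" using blocks_nonempty by auto
  then have "n + length (blocks ops) - 1 + 1 = length (replicate n {} @ rev (blocks ops))"
    by simp
  then show ?thesis
    using win_query_eq[OF acc_inv_run[OF assms(1)] assms(2), of x]
      block_freq_eq[OF assms(2), of "blocks ops" x] by metis
qed

end

theorem theorem4:
  fixes k n :: nat
  assumes "k \<ge> 1" and "root k (real n) \<in> \<nat>"
  shows "solves_interval_problem n (ACC k n :: ('a acc_state, 'a) block_algorithm)"
proof (cases "n = 0")
  \<comment> \<open>Only empty windows can be queried, and both sides are 0.\<close>
  case True
  then show ?thesis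
    by (simp add: solves_interval_problem_def ACC_def acc_interval_query_def acc_win_query_def
        interval_freq_def Let_def)
next
  case False
  obtain d where d: "root k (real n) = real d" using assms(2) by (auto elim: Nats_cases)
  have "real d ^ k = real n" using d assms(1) by (metis of_nat_0_le_iff real_root_pow_pos2 less_le_trans zero_less_one)
  then have n: "n = d ^ k" by (metis of_nat_eq_iff of_nat_power)
  \<comment> \<open>The root is exactly \<open>d\<close>, so the floor in \<open>acc_d\<close>
    returns it; \<open>n \<noteq> 0\<close> makes \<open>d\<close> positive.\<close>
  interpret acc_params k n d
    using assms(1) False n d by unfold_locales (auto simp: acc_d_def intro!: gr0I)
  show ?thesis
    unfolding solves_interval_problem_def
  proof (intro allI impI)
    fix ops :: "'a block_op list" and x i j
    assume "admissible ops" "i \<le> j" "j \<le> n"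
    then show "alg_interval_query (ACC k n) (alg_run (ACC k n) ops) x i j =
        interval_freq (blocks ops) x i j"
      using win_query_run[of ops i x] win_query_run[of ops j x]
      by (simp add: ACC_def acc_interval_query_def interval_freq_def block_freq_def)
  qed
qed

end
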